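(* Let $\mathbb{F}_q$ be a finite field, $m\ge 1$, and let $L$ be a set of monomials in $R=\mathbb{F}_q[x_1,\ldots,x_m]$, each of degree less than $q$ in every variable, such that $L$ is closed under divisibility and has the Borel property. Then every lower triangular affine transformation $T(x)=Ax+b$ (with $A$ an invertible lower triangular $m\times m$ matrix over $\mathbb{F}_q$ and $b\in\mathbb{F}_q^m$) is an affine permutation of the code $L(\mathbb{F}_q^m)$; i.e. $\mathrm{LTA}_m\subseteq \mathrm{Perm}_A(L(\mathbb{F}_q^m))$.
   Context: For a Cartesian set $\mathcal{A}=\prod_{i=1}^m A_i$ with $A_i\subseteq\mathbb{F}_q$, $n_i=|A_i|\ge 2$, let $\Delta$ be the set of monomials $u$ with $\deg_{x_i}u<n_i$ for all $i$; for $L\subseteq\Delta$ the monomial Cartesian code is $L(\mathcal{A})=\mathrm{Span}_{\mathbb{F}_q}\{(f(P_1),\ldots,f(P_n)) : f\in L\}$ where $\mathcal{A}=\{P_1,\ldots,P_n\}$. The vanishing ideal of $\mathcal{A}$ is $I_{\mathcal{A}}=\left(\prod_{\alpha\in A_j}(x_j-\alpha)\right)_{j=1}^m$, and for $g\in R$, $\overline{g}$ denotes the unique polynomial in $\mathrm{Span}_{\mathbb{F}_q}(\Delta)$ with $g-\overline{g}\in I_{\mathcal{A}}$. An affine transformation $T(x)=Ax+b$ ($A$ an $m\times m$ matrix over $\mathbb{F}_q$, $b\in\mathbb{F}_q^m$) acts on points by $P\mapsto AP+b$ and on polynomials by $T(f)=f(y_1,\ldots,y_m)$ where $(y_1,\ldots,y_m)^t=A(x_1,\ldots,x_m)^t+b$.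 $T$ is an affine permutation of $L(\mathcal{A})$ if (1) $T(\mathcal{A})=\mathcal{A}$ and (2) $\overline{T(f)}\in\mathrm{Span}_{\mathbb{F}_q}(L)$ for every $f\in L$; the set of these is $\mathrm{Perm}_A(L(\mathcal{A}))$. Here $\mathcal{A}=\mathbb{F}_q^m$. A monomial set $L$ has the Borel property if whenever $u\in L$, $x_i\mid u$ and $j<i$, the monomial $\frac{x_j}{x_i}u$ is in $L$. $\mathrm{LTA}_m$ denotes the set of affine transformations $Ax+b$ with $A$ invertible lower triangular. *)

theory Defs
  imports "HOL-Analysis.Finite_Cartesian_Product" "HOL-Library.Poly_Mapping"
begin

text \<open>
  The variables \<open>x\<^sub>1, \<dots>, x\<^sub>m\<close> are indexed by a nonempty finite type \<open>'m\<close>, linearly ordered where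
  the order of the variables matters. A monomial is its exponent vector, so the product of
  monomials is addition.
\<close>

type_synonym 'm monomial = "'m \<Rightarrow>\<^sub>0 nat"
type_synonym ('m, 'a) mpoly = "('m \<Rightarrow>\<^sub>0 nat) \<Rightarrow>\<^sub>0 'a"

definition mon_dvd :: "'m monomial \<Rightarrow> 'm monomial \<Rightarrow> bool" where
  "mon_dvd v u \<longleftrightarrow> (\<exists>w. u = v + w)"

definition mon_var :: "'m \<Rightarrow> 'm monomial" where
  "mon_var i = Poly_Mapping.single i 1"

definition mpoly_of_mon :: "'m monomial \<Rightarrow> ('m, 'a::field) mpoly" where
  "mpoly_of_mon u = Poly_Mapping.single u 1"

definition mpoly_const :: "'a \<Rightarrow> ('m, 'a::field) mpoly" where
  "mpoly_const c = Poly_Mapping.single 0 c"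

definition mpoly_var :: "'m \<Rightarrow> ('m, 'a::field) mpoly" where
  "mpoly_var i = mpoly_of_mon (mon_var i)"

definition mpoly_scale :: "'a \<Rightarrow> ('m, 'a::field) mpoly \<Rightarrow> ('m, 'a) mpoly" where
  "mpoly_scale c f = mpoly_const c * f"

global_interpretation mpoly: vector_space mpoly_scale
  by unfold_locales
    (simp_all add: mpoly_scale_def mpoly_const_def algebra_simps single_add mult_single
      flip: mult.assoc)

definition mon_span :: "'m monomial set \<Rightarrow> ('m, 'a::field) mpoly set" where
  "mon_span L = mpoly.span (mpoly_of_mon ` L)"

definition mpoly_eval :: "('m::finite, 'a::field) mpoly \<Rightarrow> 'a ^ 'm \<Rightarrow> 'a" where
  "mpoly_eval f P =
    (\<Sum>u\<in>Poly_Mapping.keys f. Poly_Mapping.lookup f u * (\<Prod>i\<in>UNIV. (P $ i) ^ Poly_Mapping.lookup u i))"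

definition mpoly_subst ::
    "('m::finite \<Rightarrow> ('m, 'a::field) mpoly) \<Rightarrow> ('m, 'a) mpoly \<Rightarrow> ('m, 'a) mpoly" where
  "mpoly_subst y f =
    (\<Sum>u\<in>Poly_Mapping.keys f.
      mpoly_scale (Poly_Mapping.lookup f u) (\<Prod>i\<in>UNIV. y i ^ Poly_Mapping.lookup u i))"

definition cartesian_set :: "('m::finite \<Rightarrow> 'a set) \<Rightarrow> ('a ^ 'm) set" where
  "cartesian_set S = {P. \<forall>i. P $ i \<in> S i}"

definition reduced_monomials :: "('m \<Rightarrow> 'a set) \<Rightarrow> 'm monomial set" where
  "reduced_monomials S = {u. \<forall>i. Poly_Mapping.lookup u i < card (S i)}"

text \<open>
  Codewords are indexed by the points of the Cartesian set instead of by an enumeration of them.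
\<close>

definition monomial_cartesian_code ::
    "('m::finite \<Rightarrow> 'a::field set) \<Rightarrow> 'm monomial set \<Rightarrow> ('a ^ 'm \<Rightarrow> 'a) set" where
  "monomial_cartesian_code S L =
    {restrict (\<lambda>P. \<Sum>u\<in>M. c u * mpoly_eval (mpoly_of_mon u) P) (cartesian_set S) | M c.
      finite M \<and> M \<subseteq> L}"

definition vanishing_ideal :: "('m::finite \<Rightarrow> 'a::field set) \<Rightarrow> ('m, 'a) mpoly set" where
  "vanishing_ideal S =
    {\<Sum>j\<in>UNIV. g j * (\<Prod>\<alpha>\<in>S j. mpoly_var j - mpoly_const \<alpha>) | g. True}"

definition mpoly_reduce ::
    "('m::finite \<Rightarrow> 'a::field set) \<Rightarrow> ('m, 'a) mpoly \<Rightarrow> ('m, 'a) mpoly" where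
  "mpoly_reduce S g = (THE h. h \<in> mon_span (reduced_monomials S) \<and> g - h \<in> vanishing_ideal S)"

text \<open>
  An affine transformation \<open>T(x) = A x + b\<close> is the pair \<open>(A, b)\<close>, with \<open>A\<close> not necessarily
  invertible.
\<close>

type_synonym ('m, 'a) affine = "('a ^ 'm ^ 'm) \<times> ('a ^ 'm)"

definition affine_point :: "('m::finite, 'a::field) affine \<Rightarrow> 'a ^ 'm \<Rightarrow> 'a ^ 'm" where
  "affine_point T P = fst T *v P + snd T"

definition affine_mpoly ::
    "('m::finite, 'a::field) affine \<Rightarrow> ('m, 'a) mpoly \<Rightarrow> ('m, 'a) mpoly" where
  "affine_mpoly T = mpoly_subst
    (\<lambda>i. (\<Sum>j\<in>UNIV. mpoly_scale (fst T $ i $ j) (mpoly_var j)) + mpoly_const (snd T $ i))"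

text \<open>
  The affine permutations of \<open>monomial_cartesian_code S L\<close>. The defining conditions refer to the
  data \<open>S\<close> and \<open>L\<close> presenting the code, which are therefore the arguments.
\<close>

definition affine_perms ::
    "('m::finite \<Rightarrow> 'a::field set) \<Rightarrow> 'm monomial set \<Rightarrow> ('m, 'a) affine set" where
  "affine_perms S L =
    {T. affine_point T ` cartesian_set S = cartesian_set S \<and>
        (\<forall>u\<in>L. mpoly_reduce S (affine_mpoly T (mpoly_of_mon u)) \<in> mon_span L)}"

definition closed_under_divisibility :: "'m monomial set \<Rightarrow> bool" where
  "closed_under_divisibility L \<longleftrightarrow> (\<forall>u\<in>L. \<forall>v. mon_dvd v u \<longrightarrow> v \<in> L)"

definition borel_property :: "'m::linorder monomial set \<Rightarrow> bool" where
  "borel_property L \<longleftrightarrow>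
    (\<forall>u\<in>L. \<forall>i j. mon_dvd (mon_var i) u \<and> j < i \<longrightarrow> (u - mon_var i) + mon_var j \<in> L)"

definition lower_triangular :: "(('a::zero, 'm::{finite,linorder}) vec, 'm) vec \<Rightarrow> bool" where
  "lower_triangular A \<longleftrightarrow> (\<forall>i j. i < j \<longrightarrow> A $ i $ j = 0)"

definition LTA :: "('m::{finite,linorder}, 'a::field) affine set" where
  "LTA = {(A, b). invertible A \<and> lower_triangular A}"

end

theory Submission
  imports Defs "HOL-Analysis.Cartesian_Space" "HOL-Computational_Algebra.Polynomial"
begin

text \<open>
  Expanding \<open>T(u)\<close> one variable at a time replaces a factor \<open>x\<^sub>i\<close> by some \<open>x\<^sub>j\<close> with \<open>j \<le> i\<close>
  or by a constant. These are exactly the moves allowed by the Borel property and by closure under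
  divisibility, so \<open>T(u)\<close> lies in the span of \<open>L\<close>. As \<open>L\<close> consists of reduced monomials,
  \<open>T(u)\<close> equals its own reduction: a reduced polynomial vanishing on the Cartesian set is zero.
\<close>

subsection \<open>Evaluation of polynomials\<close>

lemma poly_mapping_eq_sum_single:
  "f = (\<Sum>u\<in>Poly_Mapping.keys f. Poly_Mapping.single u (Poly_Mapping.lookup f u))"
  by (rule poly_mapping_eqI) (simp add: lookup_sum lookup_single when_def in_keys_iff)

text \<open>Coefficients outside the support are zero. The freedom in \<open>M\<close> gives two
  polynomials a common index set, so that their evaluations can be added termwise.\<close>

lemma mpoly_eval_superset:
  assumes "finite M" "Poly_Mapping.keys f \<subseteq> M"
  shows "mpoly_eval f P =
    (\<Sum>u\<in>M. Poly_Mapping.lookup f u * (\<Prod>i\<in>UNIV. (P $ i) ^ Poly_Mapping.lookup u i))"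
  unfolding mpoly_eval_def
  using assms by (intro sum.mono_neutral_left) (auto simp: in_keys_iff)

lemma mpoly_eval_add: "mpoly_eval (f + g) P = mpoly_eval f P + mpoly_eval g P"
proof -
  let ?M = "Poly_Mapping.keys f \<union> Poly_Mapping.keys g"
  have "Poly_Mapping.keys (f + g) \<subseteq> ?M"
    by (rule keys_add)
  then show ?thesis
    by (simp add: mpoly_eval_superset[of ?M] lookup_add distrib_right sum.distrib)
qed

lemma mpoly_eval_0 [simp]: "mpoly_eval 0 P = 0"
  by (simp add: mpoly_eval_def)

lemma mpoly_eval_diff: "mpoly_eval (f - g) P = mpoly_eval f P - mpoly_eval g P"
  using mpoly_eval_add[of "f - g" g P] by simp

lemma mpoly_eval_sum: "mpoly_eval (\<Sum>x\<in>X. f x) P = (\<Sum>x\<in>X. mpoly_eval (f x) P)"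
  by (induction X rule: infinite_finite_induct) (simp_all add: mpoly_eval_add)

lemma mpoly_eval_single:
  "mpoly_eval (Poly_Mapping.single u c) P = c * (\<Prod>i\<in>UNIV. (P $ i) ^ Poly_Mapping.lookup u i)"
  by (simp add: mpoly_eval_def)

lemma mpoly_eval_mult: "mpoly_eval (f * g) P = mpoly_eval f P * mpoly_eval g P"
proof -
  have single: "mpoly_eval (Poly_Mapping.single u c * Poly_Mapping.single v d) P =
      mpoly_eval (Poly_Mapping.single u c) P * mpoly_eval (Poly_Mapping.single v d) P" for u v c d
    by (simp add: mult_single mpoly_eval_single lookup_add power_add prod.distrib)
  show ?thesis
    \<comment> \<open>Both sides are bilinear, so writing \<open>f\<close> and \<open>g\<close> as
      sums of their terms reduces the claim to \<open>single\<close>.\<close>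
    by (subst (1 2) poly_mapping_eq_sum_single[of f], subst (1 2) poly_mapping_eq_sum_single[of g])
      (simp add: mpoly_eval_sum sum_product single)
qed

lemma mpoly_eval_const: "mpoly_eval (mpoly_const c) P = c"
  by (simp add: mpoly_const_def mpoly_eval_single)

lemma mpoly_eval_prod: "mpoly_eval (\<Prod>x\<in>X. f x) P = (\<Prod>x\<in>X. mpoly_eval (f x) P)"
proof -
  have "mpoly_eval 1 P = 1"
    using mpoly_eval_const[of 1 P] by (simp add: mpoly_const_def)
  then show ?thesis
    by (induction X rule: infinite_finite_induct) (simp_all add: mpoly_eval_mult)
qed

lemma mpoly_eval_var: "mpoly_eval (mpoly_var j) P = P $ j"
proof -
  have "(\<Prod>i\<in>UNIV. (P $ i) ^ Poly_Mapping.lookup (mon_var j) i) =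
      (\<Prod>i\<in>UNIV. if i = j then P $ i else 1)"
    by (rule prod.cong) (auto simp: mon_var_def lookup_single)
  then show ?thesis
    by (simp add: mpoly_var_def mpoly_of_mon_def mpoly_eval_single)
qed

text \<open>At a point \<open>P\<close> of the set, the factor with \<alpha> equal to
  \<open>P $ j\<close> kills the generator for \<open>j\<close>. Finiteness matters because a
  product over an infinite set is 1 by convention.\<close>

lemma mpoly_eval_vanishing_ideal:
  assumes "\<And>i. finite (S i)" "f \<in> vanishing_ideal S" "P \<in> cartesian_set S"
  shows "mpoly_eval f P = 0"
proof -
  obtain g where f: "f = (\<Sum>j\<in>UNIV. g j * (\<Prod>\<alpha>\<in>S j. mpoly_var j - mpoly_const \<alpha>))"
    using assms(2) by (auto simp: vanishing_ideal_def)
  have "(\<Prod>\<alpha>\<in>S j. P $ j - \<alpha>) = 0" for j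
    using assms by (intro prod_zero) (auto simp: cartesian_set_def)
  then show ?thesis
    by (simp add: f mpoly_eval_sum mpoly_eval_mult mpoly_eval_prod mpoly_eval_diff
        mpoly_eval_var mpoly_eval_const)
qed

subsection \<open>Uniqueness of reduced polynomials\<close>

text \<open>The weights are the coefficients of the Lagrange basis polynomials of \<open>X\<close>.\<close>

lemma coefficient_functional:
  fixes X :: "'a::field set"
  assumes "finite X"
  obtains \<psi> where "\<And>j. j < card X \<Longrightarrow> (\<Sum>x\<in>X. \<psi> x * x ^ j) = (if j = k then 1 else 0)"
proof -
  define l where "l x = (\<Prod>y\<in>X - {x}. smult (inverse (x - y)) [:- y, 1:])" for x
  have deg: "degree (l x) < card X" if "x \<in> X" for x
  proof -
    have "degree (l x) \<le> (\<Sum>y\<in>X - {x}. degree (smult (inverse (x - y)) [:- y, 1:]))"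
      unfolding l_def using assms by (intro order.trans[OF degree_prod_sum_le]) auto
    also have "\<dots> \<le> (\<Sum>y\<in>X - {x}. 1)"
      by (intro sum_mono order.trans[OF degree_smult_le]) simp
    also have "\<dots> < card X"
      using assms that card_gt_0_iff[of X] by auto
    finally show ?thesis .
  qed
  have poly_l: "poly (l x) z = (\<Prod>y\<in>X - {x}. (z - y) / (x - y))" for x z
    by (simp add: l_def poly_prod divide_inverse algebra_simps)
  have l: "poly (l x) z = (if z = x then 1 else 0)" if "x \<in> X" "z \<in> X" for x z
    using assms that by (auto simp: poly_l)
  have "(\<Sum>x\<in>X. coeff (l x) k * x ^ j) = (if j = k then 1 else 0)" if j: "j < card X" for j
  proof -
    \<comment> \<open>Lagrange interpolation reproduces the power \<open>j\<close>: both sides have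
      degree below \<open>card X\<close> and agree on \<open>X\<close>. Comparing coefficients at
      \<open>k\<close> then gives the claim.\<close>
    have "(\<Sum>x\<in>X. smult (x ^ j) (l x)) = monom 1 j"
    proof (rule poly_eqI_degree)
      show "poly (\<Sum>x\<in>X. smult (x ^ j) (l x)) z = poly (monom 1 j) z" if "z \<in> X" for z
        using assms that by (simp add: poly_sum poly_monom l if_distrib cong: if_cong)
      show "degree (\<Sum>x\<in>X. smult (x ^ j) (l x)) < card X"
        using j deg by (intro degree_sum_less) (auto intro: le_less_trans[OF degree_smult_le])
      show "degree (monom 1 j :: 'a poly) < card X"
        using j by (simp add: degree_monom_eq)
    qed
    then have "coeff (\<Sum>x\<in>X. smult (x ^ j) (l x)) k = coeff (monom 1 j) k"
      by simp
    then show ?thesis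
      by (simp add: coeff_sum mult.commute)
  qed
  then show ?thesis
    by (rule that)
qed

text \<open>Multiplying one-variable coefficient functionals, one per coordinate, recovers each
  coefficient of \<open>f\<close> as a weighted sum of its values on the grid, and these are all
  zero.\<close>

lemma reduced_mpoly_eq_0:
  fixes f :: "('m::finite, 'a::field) mpoly"
  assumes fin: "\<And>i. finite (S i)"
    and red: "Poly_Mapping.keys f \<subseteq> reduced_monomials S"
    and zero: "\<And>P. P \<in> cartesian_set S \<Longrightarrow> mpoly_eval f P = 0"
  shows "f = 0"
proof (rule poly_mapping_eqI)
  fix u
  show "Poly_Mapping.lookup f u = Poly_Mapping.lookup 0 u"
  proof (cases "u \<in> Poly_Mapping.keys f")
    case True
    have "\<exists>\<psi>. \<forall>j<card (S i). (\<Sum>x\<in>S i. \<psi> x * x ^ j) =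
        (if j = Poly_Mapping.lookup u i then 1 else 0)" for i
      by (rule coefficient_functional[OF fin, of i "Poly_Mapping.lookup u i"]) blast
    then obtain \<psi> where \<psi>: "\<And>i j. j < card (S i) \<Longrightarrow>
        (\<Sum>x\<in>S i. \<psi> i x * x ^ j) = (if j = Poly_Mapping.lookup u i then 1 else 0)"
      by metis
    \<comment> \<open>The sum over the grid factors into one-variable sums. Reducedness keeps every
      exponent in the range where \<open>\<psi>\<close> acts as a Kronecker delta.\<close>
    have delta: "(\<Sum>g\<in>PiE UNIV S. \<Prod>i\<in>UNIV. \<psi> i (g i) * g i ^ Poly_Mapping.lookup v i) =
        (if v = u then 1 else 0)" if "v \<in> Poly_Mapping.keys f" for v
    proof -
      have "(\<Sum>g\<in>PiE UNIV S. \<Prod>i\<in>UNIV. \<psi> i (g i) * g i ^ Poly_Mapping.lookup v i) =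
          (\<Prod>i\<in>UNIV. \<Sum>x\<in>S i. \<psi> i x * x ^ Poly_Mapping.lookup v i)"
        using fin by (subst prod_sum_PiE) auto
      also have "\<dots> =
          (\<Prod>i\<in>UNIV. if Poly_Mapping.lookup v i = Poly_Mapping.lookup u i then 1 else 0)"
        using red that by (intro prod.cong refl \<psi>) (auto simp: reduced_monomials_def)
      also have "\<dots> = (if v = u then 1 else 0)"
        by (auto intro!: prod_zero poly_mapping_eqI)
      finally show ?thesis .
    qed
    have "0 = (\<Sum>g\<in>PiE UNIV S. (\<Prod>i\<in>UNIV. \<psi> i (g i)) * mpoly_eval f (\<chi> i. g i))"
      by (intro sum.neutral[symmetric]) (auto simp: zero cartesian_set_def PiE_iff)
    also have "\<dots> = (\<Sum>g\<in>PiE UNIV S. \<Sum>v\<in>Poly_Mapping.keys f. Poly_Mapping.lookup f v *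
        (\<Prod>i\<in>UNIV. \<psi> i (g i) * g i ^ Poly_Mapping.lookup v i))"
      by (simp add: mpoly_eval_def sum_distrib_left prod.distrib mult_ac)
    also have "\<dots> = (\<Sum>v\<in>Poly_Mapping.keys f. Poly_Mapping.lookup f v *
        (\<Sum>g\<in>PiE UNIV S. \<Prod>i\<in>UNIV. \<psi> i (g i) * g i ^ Poly_Mapping.lookup v i))"
      by (subst sum.swap) (simp add: sum_distrib_left)
    also have "\<dots> =
        (\<Sum>v\<in>Poly_Mapping.keys f. if v = u then Poly_Mapping.lookup f v else 0)"
      by (intro sum.cong refl) (simp add: delta)
    also have "\<dots> = Poly_Mapping.lookup f u"
      using True by simp
    finally show ?thesis
      by simp
  qed (simp add: in_keys_iff)
qed

text \<open>The polynomials supported in \<open>L\<close> form a subspace that contains the spanning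
  monomials.\<close>

lemma keys_subset_mon_span:
  fixes f :: "('m, 'a::field) mpoly"
  assumes "f \<in> mon_span L"
  shows "Poly_Mapping.keys f \<subseteq> L"
proof -
  define V where "V = {f :: ('m, 'a) mpoly. Poly_Mapping.keys f \<subseteq> L}"
  have "mpoly.span (mpoly_of_mon ` L) \<subseteq> V"
  proof (rule mpoly.span_minimal)
    show "mpoly_of_mon ` L \<subseteq> V"
      by (auto simp: V_def mpoly_of_mon_def)
    show "mpoly.subspace V"
      unfolding mpoly.subspace_def
    proof (intro conjI ballI allI)
      show "0 \<in> V"
        by (simp add: V_def)
      show "f + g \<in> V" if "f \<in> V" "g \<in> V" for f g
        using that keys_add[of f g] by (auto simp: V_def)
      show "mpoly_scale c f \<in> V" if "f \<in> V" for c f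
        using that keys_mult[of "Poly_Mapping.single 0 c" f]
        by (auto simp: V_def mpoly_scale_def mpoly_const_def split: if_splits)
    qed
  qed
  then show ?thesis
    using assms by (auto simp: V_def mon_span_def)
qed

text \<open>\<open>f\<close> itself is a candidate for the definite description. Any other candidate
  differs from it by a reduced polynomial in the vanishing ideal, which is zero.\<close>

lemma mpoly_reduce_reduced:
  assumes fin: "\<And>i. finite (S i)" and f: "f \<in> mon_span (reduced_monomials S)"
  shows "mpoly_reduce S f = f"
  unfolding mpoly_reduce_def
proof (rule the_equality)
  have "0 \<in> vanishing_ideal S"
    unfolding vanishing_ideal_def by (intro CollectI exI[of _ "\<lambda>_. 0"]) simp
  then show "f \<in> mon_span (reduced_monomials S) \<and> f - f \<in> vanishing_ideal S"
    using f by simp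
next
  fix h
  assume h: "h \<in> mon_span (reduced_monomials S) \<and> f - h \<in> vanishing_ideal S"
  then have "f - h \<in> mon_span (reduced_monomials S)"
    using f by (simp add: mon_span_def mpoly.span_diff)
  then have "f - h = 0"
    using h fin
    by (intro reduced_mpoly_eq_0[of S] keys_subset_mon_span mpoly_eval_vanishing_ideal) auto
  then show "h = f"
    by simp
qed

subsection \<open>Lower triangular substitutions\<close>

lemma prod_pow_mon_var:
  fixes y :: "'m::finite \<Rightarrow> 'b::comm_semiring_1"
  shows "(\<Prod>k\<in>UNIV. y k ^ Poly_Mapping.lookup (mon_var i + u) k) =
    y i * (\<Prod>k\<in>UNIV. y k ^ Poly_Mapping.lookup u k)"
proof -
  have "(\<Prod>k\<in>UNIV. y k ^ Poly_Mapping.lookup (mon_var i) k) = (\<Prod>k\<in>UNIV. if k = i then y k else 1)"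
    by (rule prod.cong) (auto simp: mon_var_def lookup_single)
  then show ?thesis
    by (simp add: lookup_add power_add prod.distrib)
qed

lemma monomial_split_var:
  assumes "u \<noteq> 0"
  obtains i v where "u = mon_var i + v"
proof -
  obtain i where i: "Poly_Mapping.lookup u i \<noteq> 0"
    using assms by (metis poly_mapping_eqI lookup_zero)
  \<comment> \<open>Subtraction of exponents is truncated, but the exponent of \<open>i\<close> is
    positive, so nothing is lost.\<close>
  have "u = mon_var i + (u - mon_var i)"
    using i by (intro poly_mapping_eqI)
      (auto simp: lookup_add lookup_minus mon_var_def lookup_single when_def)
  then show ?thesis
    by (rule that)
qed

lemma mpoly_of_mon_add: "mpoly_of_mon (u + v) = mpoly_of_mon u * mpoly_of_mon v"
  by (simp add: mpoly_of_mon_def mult_single)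

text \<open>
  The monomial \<open>w\<close> collects the factors already expanded; the induction is on the part \<open>u\<close> still
  to be substituted.
\<close>

lemma lower_triangular_subst_mem_span:
  fixes L :: "'m::{finite,linorder} monomial set" and T :: "('m, 'a::field) affine"
  defines "y \<equiv> \<lambda>i. (\<Sum>j\<in>UNIV. mpoly_scale (fst T $ i $ j) (mpoly_var j)) + mpoly_const (snd T $ i)"
  assumes div: "closed_under_divisibility L" and bor: "borel_property L"
    and tri: "lower_triangular (fst T)" and "w + u \<in> L"
  shows "mpoly_of_mon w * (\<Prod>k\<in>UNIV. y k ^ Poly_Mapping.lookup u k) \<in> mon_span L"
  using \<open>w + u \<in> L\<close>
proof (induction "\<Sum>k\<in>UNIV. Poly_Mapping.lookup u k" arbitrary: u w rule: less_induct)
  case less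
  show ?case
  proof (cases "u = 0")
    case True
    then show ?thesis
      using less.prems by (auto simp: mon_span_def intro: mpoly.span_base)
  next
    case False
    then obtain i v where u: "u = mon_var i + v"
      by (rule monomial_split_var)
    define Q where "Q = (\<Prod>k\<in>UNIV. y k ^ Poly_Mapping.lookup v k)"
    have "(\<Sum>k\<in>UNIV. Poly_Mapping.lookup (mon_var i) k) = 1"
      by (simp add: mon_var_def lookup_single when_def)
    then have deg: "(\<Sum>k\<in>UNIV. Poly_Mapping.lookup v k) < (\<Sum>k\<in>UNIV. Poly_Mapping.lookup u k)"
      by (simp add: u lookup_add sum.distrib)
    have IH: "mpoly_of_mon w' * Q \<in> mon_span L" if "w' + v \<in> L" for w'
      unfolding Q_def using deg that by (rule less.hyps)
    \<comment> \<open>The summand of \<open>y i\<close> at \<open>x_j\<close>: for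
      \<open>i < j\<close> its coefficient is zero, for \<open>j = i\<close> the total monomial is
      still \<open>w + u\<close>, and for \<open>j < i\<close> it changes by a Borel move.\<close>
    have var: "mpoly_scale (fst T $ i $ j) (mpoly_of_mon (w + mon_var j) * Q) \<in> mon_span L" for j
    proof (cases "i < j")
      case True
      then show ?thesis
        using tri by (simp add: lower_triangular_def mon_span_def mpoly.span_zero)
    next
      case False
      have "w + mon_var j + v \<in> L"
      proof (cases "j = i")
        case True
        then show ?thesis
          using less.prems by (simp add: u add_ac)
      next
        case j: False
        have "mon_dvd (mon_var i) (w + u)"
          by (auto simp: mon_dvd_def u intro!: exI[of _ "w + v"] simp: add_ac)
        then have "w + u - mon_var i + mon_var j \<in> L"
          using bor less.prems j False unfolding borel_property_def by auto
        moreover have "w + u - mon_var i + mon_var j = w + mon_var j + v"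
          by (simp add: u add.left_commute[of w]) (simp add: add_ac)
        ultimately show ?thesis
          by simp
      qed
      then show ?thesis
        using IH by (simp add: mon_span_def mpoly.span_scale)
    qed
    \<comment> \<open>The constant summand of \<open>y i\<close> deletes one factor
      \<open>x_i\<close>, which closure under divisibility permits.\<close>
    have "mon_dvd (w + v) (w + u)"
      by (auto simp: mon_dvd_def u intro!: exI[of _ "mon_var i"] simp: add_ac)
    then have "w + v \<in> L"
      using div less.prems unfolding closed_under_divisibility_def by blast
    then have const: "mpoly_scale (snd T $ i) (mpoly_of_mon w * Q) \<in> mon_span L"
      using IH by (simp add: mon_span_def mpoly.span_scale)
    have "mpoly_of_mon w * (\<Prod>k\<in>UNIV. y k ^ Poly_Mapping.lookup u k) = mpoly_of_mon w * (y i * Q)"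
      by (simp add: u Q_def prod_pow_mon_var)
    \<comment> \<open>Only the single factor \<open>y i\<close> is expanded; each of its variables
      is absorbed into \<open>w\<close>, while \<open>Q\<close> stays unexpanded.\<close>
    also have "\<dots> = (\<Sum>j\<in>UNIV. mpoly_scale (fst T $ i $ j) (mpoly_of_mon (w + mon_var j) * Q)) +
        mpoly_scale (snd T $ i) (mpoly_of_mon w * Q)"
      by (simp add: y_def mpoly_scale_def mpoly_var_def mpoly_of_mon_add distrib_left distrib_right
          sum_distrib_left sum_distrib_right mult_ac)
    also have "\<dots> \<in> mon_span L"
      using var const by (simp add: mon_span_def mpoly.span_add mpoly.span_sum)
    finally show ?thesis .
  qed
qed

text \<open>This is the case \<open>w = 0\<close>, where no factor has been expanded yet.\<close>

lemma affine_mpoly_lower_triangular_mem_span: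
  fixes L :: "'m::{finite,linorder} monomial set" and T :: "('m, 'a::field) affine"
  assumes "closed_under_divisibility L" "borel_property L" "lower_triangular (fst T)" "u \<in> L"
  shows "affine_mpoly T (mpoly_of_mon u) \<in> mon_span L"
  using lower_triangular_subst_mem_span[OF assms(1-3), of 0 u] \<open>u \<in> L\<close>
  by (simp add: affine_mpoly_def mpoly_subst_def mpoly_of_mon_def)

text \<open>A right inverse \<open>B\<close> of the matrix gives the explicit preimage
  \<open>B *v (Q - snd T)\<close> of \<open>Q\<close>.\<close>

lemma surj_affine_point:
  fixes T :: "('m::finite, 'a::field) affine"
  assumes "invertible (fst T)"
  shows "surj (affine_point T)"
proof -
  obtain B where "fst T ** B = mat 1"
    using assms unfolding invertible_def by blast
  then have "affine_point T (B *v (Q - snd T)) = Q" for Q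
    by (simp add: affine_point_def matrix_vector_mul_assoc)
  then show ?thesis
    by (rule surjI)
qed

theorem theorem1:
  fixes L :: "('m::{finite,linorder}) monomial set"
  assumes "L \<subseteq> reduced_monomials (\<lambda>_::'m. UNIV :: 'a::{field,finite} set)"
    and "closed_under_divisibility L"
    and "borel_property L"
  shows "(LTA :: ('m, 'a) affine set) \<subseteq> affine_perms (\<lambda>_. UNIV) L"
proof
  fix T :: "('m, 'a) affine"
  assume "T \<in> LTA"
  then have T: "invertible (fst T)" "lower_triangular (fst T)"
    by (auto simp: LTA_def)
  have span: "(mon_span L :: ('m, 'a) mpoly set) \<subseteq> mon_span (reduced_monomials (\<lambda>_. UNIV :: 'a set))"
    unfolding mon_span_def by (intro mpoly.span_mono image_mono assms(1))
  have "mpoly_reduce (\<lambda>_. UNIV) (affine_mpoly T (mpoly_of_mon u)) \<in> mon_span L" if "u \<in> L" for u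
  proof -
    have "affine_mpoly T (mpoly_of_mon u) \<in> mon_span L"
      using assms(2,3) T(2) that by (rule affine_mpoly_lower_triangular_mem_span)
    then show ?thesis
      using span by (subst mpoly_reduce_reduced) auto
  qed
  \<comment> \<open>The Cartesian set is the whole space here, so preserving it amounts to
    surjectivity of the point map.\<close>
  then show "T \<in> affine_perms (\<lambda>_. UNIV) L"
    using surj_affine_point[OF T(1)] by (simp add: affine_perms_def cartesian_set_def)
qed

end
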